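(* Let $k\ge N+1$, let $\bar x\in\mathcal F_k$, and suppose that (in the noise-free setting described in the context): (1) Invertibility: $A\in\mathbb R^{n\times n}$ is invertible. (2) Nondegeneracy at $\bar x$: for all $i=0,\dots,N$ and $s\in\{+,-\}$, if $\varphi_i^s(\bar x)=0$ then $\nabla\varphi_i^s(\bar x)\neq 0$. (3) Aggregated constraint qualification at $\bar x$: if $y\in N_D(F(\bar x))$ and $\nabla F(\bar x)^*y=0$, then $y=0$. Then the set $\mathcal F_k$ is strongly amenable at $\bar x$, and $\mathcal F_k$ is prox-regular at $\bar x$.
   Context: System (noise-free). $x_{k+1}=Ax_k$, $z_k=x_k^\top Vx_k$, with $x_k\in\mathbb R^n$, $A\in\mathbb R^{n\times n}$, and $V\in\mathbb R^{n\times n}$ symmetric positive definite. $\|\cdot\|$ is the Euclidean norm, $L=\|V\|_2$ is the spectral norm of $V$, $N\ge 0$ is an integer (number of past constraints), and $\zeta\ge 0$ is a tolerance, taken as $\zeta=0$ in this noise-free setting. For a symmetric positive semidefinite matrix $P$, $\|v\|_P^2=v^\top Pv$. Quadratic observer. $Q\succ0$ is an $n\times n$ symmetric matrix and $\eta>0$. Start-up values $\hat x^Q_{j|j}\in\mathbb R^n$ for $0\le j\le N$ and a symmetric positive semidefinite $P^Q_{N|N}$ are given. At each time $j\ge1$ the prior is $\hat x^Q_{j|j-1}=A\hat x^Q_{j-1|j-1}$, and $H_j=(2V\hat x^Q_{j|j-1})^\top$, $\tilde z_j=z_j-(\hat x^Q_{j|j-1})^\top V\hat x^Q_{j|j-1}$.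 For $k\ge N+1$: $P^Q_{k|k-1}=AP^Q_{k-1|k-1}A^\top+Q$, $K_k=P^Q_{k|k-1}H_k^\top(H_kP^Q_{k|k-1}H_k^\top+\eta)^{-1}$, $P^Q_{k|k}=(I-K_kH_k)P^Q_{k|k-1}$, $\tilde x_{k|k}=\hat x^Q_{k|k-1}+K_k\tilde z_k$, and $\hat x^Q_{k|k}$ is a minimizer of $\|x-\tilde x_{k|k}\|^2_{(P^Q_{k|k})^{-1}}$ over $x\in\mathcal F_k$. Feasible set. For $k\ge N+1$ and $i=0,\dots,N$ let $\delta_{k,i}(x)=\zeta+L\|A^{-i}x-\hat x^Q_{k-i|k-i-1}\|^2$ and $$\mathcal F_k=\bigcap_{i=0}^N\{x\in\mathbb R^n:\ |H_{k-i}(A^{-i}x-\hat x^Q_{k-i|k-i-1})-\tilde z_{k-i}|\le\delta_{k,i}(x)\}.$$ Define $\varphi_i^+(x)=H_{k-i}(A^{-i}x-\hat x^Q_{k-i|k-i-1})-\tilde z_{k-i}-\delta_{k,i}(x)$ and $\varphi_i^-(x)=-H_{k-i}(A^{-i}x-\hat x^Q_{k-i|k-i-1})+\tilde z_{k-i}-\delta_{k,i}(x)$, $F(x)=(\varphi_0^+(x),\varphi_0^-(x),\dots,\varphi_N^+(x),\varphi_N^-(x))^\top$, and $D=(-\infty,0]^{2(N+1)}$, so that $\mathcal F_k=\{x\in\mathbb R^n:F(x)\in D\}$. $N_D(u)$ is the normal cone to $D$ at $u$, and $\nabla F(\bar x)^*$ is the transpose of the Jacobian of $F$ at $\bar x$.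 Variational notions (Rockafellar–Wets). A set $C\subset\mathbb R^n$ is strongly amenable at $\bar x\in C$ if there are an open neighborhood $O$ of $\bar x$, a $C^2$ mapping $G:O\to\mathbb R^m$ and a closed convex set $E\subset\mathbb R^m$ such that $C\cap O=\{x\in O:G(x)\in E\}$ and the only $y\in N_E(G(\bar x))$ with $\nabla G(\bar x)^*y=0$ is $y=0$. $C$ is prox-regular at $\bar x\in C$ if $C$ is locally closed at $\bar x$ and, for every $\bar v\in N_C(\bar x)$ (the limiting normal cone), there are $\varepsilon>0$, $\rho\ge0$ such that $\langle v,x'-x\rangle\le\frac{\rho}{2}\|x'-x\|^2$ for all $x'\in C$ with $\|x'-\bar x\|<\varepsilon$, whenever $x\in C$, $v\in N_C(x)$, $\|x-\bar x\|<\varepsilon$, $\|v-\bar v\|<\varepsilon$. *)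

theory Defs
  imports "HOL-Analysis.Analysis"
begin

section \<open>Matrices\<close>

definition pos_semidef :: "real^'n^'n \<Rightarrow> bool" where
  "pos_semidef P \<longleftrightarrow> transpose P = P \<and> (\<forall>v. 0 \<le> v \<bullet> (P *v v))"

definition pos_def :: "real^'n^'n \<Rightarrow> bool" where
  "pos_def P \<longleftrightarrow> transpose P = P \<and> (\<forall>v. v \<noteq> 0 \<longrightarrow> 0 < v \<bullet> (P *v v))"

definition spectral_norm :: "real^'n^'n \<Rightarrow> real" where
  "spectral_norm V = onorm ((*v) V)"

definition sq_norm_wrt :: "real^'n^'n \<Rightarrow> real^'n \<Rightarrow> real" where
  "sq_norm_wrt P v = v \<bullet> (P *v v)"

text \<open>The vector \<open>A\<^sup>-\<^sup>i x\<close>, by iteration: there is no power operation for \<open>**\<close>.\<close>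
definition inv_pow_mult :: "real^'n^'n \<Rightarrow> nat \<Rightarrow> real^'n \<Rightarrow> real^'n" where
  "inv_pow_mult A i = ((*v) (matrix_inv A)) ^^ i"


section \<open>Variational notions\<close>

definition grad :: "('a::euclidean_space \<Rightarrow> real) \<Rightarrow> 'a \<Rightarrow> 'a" where
  "grad f x = (THE D. GDERIV f x :> D)"

lemma grad_eqI:
  assumes "GDERIV f x :> D"
  shows "grad f x = D"
  unfolding grad_def
proof (rule the_equality)
  fix D' assume "GDERIV f x :> D'"
  with assms have "(\<lambda>h. h \<bullet> D') = (\<lambda>h. h \<bullet> D)"
    unfolding gderiv_def by (rule has_derivative_unique[rotated])
  then show "D' = D"
    by (simp add: fun_eq_iff vector_eq_ldot)
qed (rule assms)

definition C2_on :: "'a::euclidean_space set \<Rightarrow> ('a \<Rightarrow> real) \<Rightarrow> bool" where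
  "C2_on U f \<longleftrightarrow> (\<exists>(g :: 'a \<Rightarrow> 'a) (h :: 'a \<Rightarrow> 'a \<Rightarrow>\<^sub>L 'a).
     (\<forall>x\<in>U. (GDERIV f x :> g x) \<and> (g has_derivative blinfun_apply (h x)) (at x)) \<and>
     continuous_on U h)"

text \<open>Since the dimension \<open>m\<close> of the target space is quantified inside strong amenability,
  \<open>\<real>\<^sup>m\<close> is the library's \<open>Euclidean_space m\<close>: functions \<open>nat \<Rightarrow> real\<close> vanishing
  at all indices \<open>\<ge> m\<close>.\<close>

definition convex_in :: "(nat \<Rightarrow> real) set \<Rightarrow> bool" where
  "convex_in E \<longleftrightarrow>
     (\<forall>u\<in>E. \<forall>w\<in>E. \<forall>t\<in>{0..1}. (\<lambda>j. (1 - t) * u j + t * w j) \<in> E)"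

text \<open>The normal cone of convex analysis; only used for closed convex \<open>E \<subseteq> \<real>\<^sup>m\<close>.\<close>
definition convex_normal_cone ::
    "nat \<Rightarrow> (nat \<Rightarrow> real) set \<Rightarrow> (nat \<Rightarrow> real) \<Rightarrow> (nat \<Rightarrow> real) set" where
  "convex_normal_cone m E u =
     {y \<in> topspace (Euclidean_space m). u \<in> E \<and> (\<forall>w\<in>E. (\<Sum>j<m. y j * (w j - u j)) \<le> 0)}"

text \<open>\<open>\<nabla>G(x)\<^sup>* y\<close> for a map \<open>G\<close> into \<open>\<real>\<^sup>m\<close>; the rows of the Jacobian are the gradients of
  the components.\<close>
definition adjoint_jacobian ::
    "nat \<Rightarrow> ('a::euclidean_space \<Rightarrow> nat \<Rightarrow> real) \<Rightarrow> 'a \<Rightarrow> (nat \<Rightarrow> real) \<Rightarrow> 'a" where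
  "adjoint_jacobian m G x y = (\<Sum>j<m. y j *\<^sub>R grad (\<lambda>x'. G x' j) x)"

definition strongly_amenable :: "'a::euclidean_space set \<Rightarrow> 'a \<Rightarrow> bool" where
  "strongly_amenable C xb \<longleftrightarrow> xb \<in> C \<and>
     (\<exists>U m G E. open U \<and> xb \<in> U \<and>
        G \<in> U \<rightarrow> topspace (Euclidean_space m) \<and>
        (\<forall>j<m. C2_on U (\<lambda>x. G x j)) \<and>
        closedin (Euclidean_space m) E \<and> convex_in E \<and>
        C \<inter> U = {x \<in> U. G x \<in> E} \<and>
        (\<forall>y \<in> convex_normal_cone m E (G xb). adjoint_jacobian m G xb y = 0 \<longrightarrow> y = (\<lambda>_. 0)))"

text \<open>Regular (Frechet) normals: \<open>\<langle>v, x' - x\<rangle> \<le> o(\<parallel>x' - x\<parallel>)\<close> for \<open>x' \<in> C\<close>.\<close>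
definition regular_normal_cone :: "'a::euclidean_space set \<Rightarrow> 'a \<Rightarrow> 'a set" where
  "regular_normal_cone C x =
     {v. x \<in> C \<and> (\<forall>e>0. \<exists>d>0. \<forall>x'\<in>C. norm (x' - x) < d \<longrightarrow> v \<bullet> (x' - x) \<le> e * norm (x' - x))}"

definition limiting_normal_cone :: "'a::euclidean_space set \<Rightarrow> 'a \<Rightarrow> 'a set" where
  "limiting_normal_cone C x =
     {v. x \<in> C \<and> (\<exists>xs vs. (\<forall>n. vs n \<in> regular_normal_cone C (xs n)) \<and>
                       xs \<longlonglongrightarrow> x \<and> vs \<longlonglongrightarrow> v)}"

definition locally_closed_at :: "'a::euclidean_space set \<Rightarrow> 'a \<Rightarrow> bool" where
  "locally_closed_at C x \<longleftrightarrow> (\<exists>e>0. closed (C \<inter> cball x e))"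

definition prox_regular :: "'a::euclidean_space set \<Rightarrow> 'a \<Rightarrow> bool" where
  "prox_regular C xb \<longleftrightarrow> xb \<in> C \<and> locally_closed_at C xb \<and>
     (\<forall>vb \<in> limiting_normal_cone C xb. \<exists>\<epsilon>>0. \<exists>\<rho>\<ge>0.
        \<forall>x\<in>C. \<forall>v \<in> limiting_normal_cone C x.
          norm (x - xb) < \<epsilon> \<longrightarrow> norm (v - vb) < \<epsilon> \<longrightarrow>
          (\<forall>x'\<in>C. norm (x' - xb) < \<epsilon> \<longrightarrow> v \<bullet> (x' - x) \<le> \<rho> / 2 * (norm (x' - x))\<^sup>2))"


section \<open>The quadratic observer and its feasible sets\<close>

text \<open>Throughout, \<open>xh j\<close> and \<open>P j\<close> stand for the posterior quantities at time \<open>j\<close>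
  (index \<open>j|j\<close>); the priors (index \<open>j|j-1\<close>) are only meaningful for \<open>j \<ge> 1\<close>.\<close>

definition prior :: "real^'n^'n \<Rightarrow> (nat \<Rightarrow> real^'n) \<Rightarrow> nat \<Rightarrow> real^'n" where
  "prior A xh j = A *v xh (j - 1)"

definition obs_row :: "real^'n^'n \<Rightarrow> real^'n^'n \<Rightarrow> (nat \<Rightarrow> real^'n) \<Rightarrow> nat \<Rightarrow> real^'n^1" where
  "obs_row A V xh j = rowvector (2 *\<^sub>R (V *v prior A xh j))"

definition innovation ::
    "real^'n^'n \<Rightarrow> real^'n^'n \<Rightarrow> (nat \<Rightarrow> real) \<Rightarrow> (nat \<Rightarrow> real^'n) \<Rightarrow> nat \<Rightarrow> real" where
  "innovation A V z xh j = z j - prior A xh j \<bullet> (V *v prior A xh j)"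

text \<open>\<open>H\<^sub>k\<^sub>-\<^sub>i (A\<^sup>-\<^sup>i x - xh\<^sub>k\<^sub>-\<^sub>i\<^sub>|\<^sub>k\<^sub>-\<^sub>i\<^sub>-\<^sub>1)\<close>, a one-by-one matrix read as a number.\<close>
definition lin_pred ::
    "real^'n^'n \<Rightarrow> real^'n^'n \<Rightarrow> (nat \<Rightarrow> real^'n) \<Rightarrow> nat \<Rightarrow> nat \<Rightarrow> real^'n \<Rightarrow> real" where
  "lin_pred A V xh k i x =
     (obs_row A V xh (k - i) *v (inv_pow_mult A i x - prior A xh (k - i))) $ 1"

definition delta ::
    "real^'n^'n \<Rightarrow> real^'n^'n \<Rightarrow> real \<Rightarrow> (nat \<Rightarrow> real^'n) \<Rightarrow> nat \<Rightarrow> nat \<Rightarrow> real^'n \<Rightarrow> real" where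
  "delta A V \<zeta> xh k i x =
     \<zeta> + spectral_norm V * (norm (inv_pow_mult A i x - prior A xh (k - i)))\<^sup>2"

definition feasible ::
    "real^'n^'n \<Rightarrow> real^'n^'n \<Rightarrow> nat \<Rightarrow> real \<Rightarrow> (nat \<Rightarrow> real) \<Rightarrow> (nat \<Rightarrow> real^'n) \<Rightarrow> nat \<Rightarrow>
     (real^'n) set" where
  "feasible A V N \<zeta> z xh k =
     (\<Inter>i\<in>{0..N}. {x. \<bar>lin_pred A V xh k i x - innovation A V z xh (k - i)\<bar> \<le> delta A V \<zeta> xh k i x})"

definition P_prior ::
    "real^'n^'n \<Rightarrow> real^'n^'n \<Rightarrow> (nat \<Rightarrow> real^'n^'n) \<Rightarrow> nat \<Rightarrow> real^'n^'n" where
  "P_prior A Q P k = A ** P (k - 1) ** transpose A + Q"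

definition gain ::
    "real^'n^'n \<Rightarrow> real^'n^'n \<Rightarrow> real^'n^'n \<Rightarrow> real \<Rightarrow> (nat \<Rightarrow> real^'n) \<Rightarrow> (nat \<Rightarrow> real^'n^'n) \<Rightarrow>
     nat \<Rightarrow> real^1^'n" where
  "gain A V Q \<eta> xh P k =
     (let H = obs_row A V xh k; M = P_prior A Q P k
      in M ** transpose H ** matrix_inv (H ** M ** transpose H + mat \<eta>))"

definition unconstrained_update ::
    "real^'n^'n \<Rightarrow> real^'n^'n \<Rightarrow> real^'n^'n \<Rightarrow> real \<Rightarrow> (nat \<Rightarrow> real) \<Rightarrow> (nat \<Rightarrow> real^'n) \<Rightarrow>
     (nat \<Rightarrow> real^'n^'n) \<Rightarrow> nat \<Rightarrow> real^'n" where
  "unconstrained_update A V Q \<eta> z xh P k =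
     prior A xh k + gain A V Q \<eta> xh P k *v vec (innovation A V z xh k)"

text \<open>\<open>(xh, P)\<close> is a run of the observer on the measurements \<open>z\<close>. It is a relation because
  the minimizer need not be unique. The values \<open>xh 0, \<dots>, xh N\<close> are arbitrary start-up values;
  \<open>P j\<close> plays no role for \<open>j < N\<close>.\<close>
definition quadratic_observer ::
    "real^'n^'n \<Rightarrow> real^'n^'n \<Rightarrow> nat \<Rightarrow> real \<Rightarrow> real^'n^'n \<Rightarrow> real \<Rightarrow> (nat \<Rightarrow> real) \<Rightarrow>
     (nat \<Rightarrow> real^'n) \<Rightarrow> (nat \<Rightarrow> real^'n^'n) \<Rightarrow> bool" where
  "quadratic_observer A V N \<zeta> Q \<eta> z xh P \<longleftrightarrow>
     pos_semidef (P N) \<and>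
     (\<forall>k\<ge>N + 1.
        P k = (mat 1 - gain A V Q \<eta> xh P k ** obs_row A V xh k) ** P_prior A Q P k \<and>
        is_arg_min
          (\<lambda>x. sq_norm_wrt (matrix_inv (P k)) (x - unconstrained_update A V Q \<eta> z xh P k))
          (\<lambda>x. x \<in> feasible A V N \<zeta> z xh k) (xh k))"


section \<open>The constraint map\<close>

definition phi_plus ::
    "real^'n^'n \<Rightarrow> real^'n^'n \<Rightarrow> real \<Rightarrow> (nat \<Rightarrow> real) \<Rightarrow> (nat \<Rightarrow> real^'n) \<Rightarrow> nat \<Rightarrow> nat \<Rightarrow>
     real^'n \<Rightarrow> real" where
  "phi_plus A V \<zeta> z xh k i x =
     lin_pred A V xh k i x - innovation A V z xh (k - i) - delta A V \<zeta> xh k i x"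

definition phi_minus ::
    "real^'n^'n \<Rightarrow> real^'n^'n \<Rightarrow> real \<Rightarrow> (nat \<Rightarrow> real) \<Rightarrow> (nat \<Rightarrow> real^'n) \<Rightarrow> nat \<Rightarrow> nat \<Rightarrow>
     real^'n \<Rightarrow> real" where
  "phi_minus A V \<zeta> z xh k i x =
     - lin_pred A V xh k i x + innovation A V z xh (k - i) - delta A V \<zeta> xh k i x"

text \<open>Component \<open>2i\<close> is \<open>\<phi>\<^sub>i\<^sup>+\<close>, component \<open>2i+1\<close> is \<open>\<phi>\<^sub>i\<^sup>-\<close>, for \<open>i \<le> N\<close>.\<close>
definition constraint_map ::
    "real^'n^'n \<Rightarrow> real^'n^'n \<Rightarrow> nat \<Rightarrow> real \<Rightarrow> (nat \<Rightarrow> real) \<Rightarrow> (nat \<Rightarrow> real^'n) \<Rightarrow> nat \<Rightarrow>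
     real^'n \<Rightarrow> nat \<Rightarrow> real" where
  "constraint_map A V N \<zeta> z xh k x j =
     (if j < 2 * (N + 1)
      then (if even j then phi_plus A V \<zeta> z xh k (j div 2) x
            else phi_minus A V \<zeta> z xh k (j div 2) x)
      else 0)"

definition nonpos_orthant :: "nat \<Rightarrow> (nat \<Rightarrow> real) set" where
  "nonpos_orthant m = {u \<in> topspace (Euclidean_space m). \<forall>j<m. u j \<le> 0}"

lemma feasible_eq_constraint_map:
  "feasible A V N \<zeta> z xh k =
     {x. constraint_map A V N \<zeta> z xh k x \<in> nonpos_orthant (2 * (N + 1))}"
proof -
  have "x \<in> feasible A V N \<zeta> z xh k \<longleftrightarrow>
      (\<forall>i\<le>N. phi_plus A V \<zeta> z xh k i x \<le> 0 \<and> phi_minus A V \<zeta> z xh k i x \<le> 0)" for x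
    unfolding feasible_def phi_plus_def phi_minus_def
    by (simp add: abs_le_iff algebra_simps INT_iff del: INT_simps) (auto simp: Ball_def)
  moreover have "constraint_map A V N \<zeta> z xh k x \<in> nonpos_orthant (2 * (N + 1)) \<longleftrightarrow>
      (\<forall>i\<le>N. phi_plus A V \<zeta> z xh k i x \<le> 0 \<and> phi_minus A V \<zeta> z xh k i x \<le> 0)" (is "?l \<longleftrightarrow> ?r") for x
  proof
    assume l: ?l
    show ?r
    proof (intro allI impI)
      fix i assume "i \<le> N"
      then have "2 * i < 2 * (N + 1)" "2 * i + 1 < 2 * (N + 1)" by auto
      with l have "constraint_map A V N \<zeta> z xh k x (2 * i) \<le> 0"
        "constraint_map A V N \<zeta> z xh k x (2 * i + 1) \<le> 0"
        unfolding nonpos_orthant_def by blast+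
      then show "phi_plus A V \<zeta> z xh k i x \<le> 0 \<and> phi_minus A V \<zeta> z xh k i x \<le> 0"
        using \<open>i \<le> N\<close> by (simp add: constraint_map_def)
    qed
  next
    assume ?r
    then show ?l
      unfolding nonpos_orthant_def constraint_map_def topspace_Euclidean_space by simp
  qed
  ultimately show ?thesis by blast
qed

end

theory Submission
  imports Defs
begin

text \<open>\<open>feasible\<close> is the preimage of the nonpositive orthant under a map whose
  components are concave quadratics \<open>a + b . (T x - p) - L |T x - p|^2\<close>. Such a map is
  smooth on the whole space, so with the orthant as convex set the aggregated constraint
  qualification is word for word the condition that strong amenability asks for.

  Prox-regularity is proved directly. The qualification makes the gradients active at
  \<open>xb\<close> positively independent, so by Gordan's alternative
  (\<open>Gordan_direction\<close>) some \<open>d\<close> makes an inner product below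
  \<open>- \<delta>\<close> with each of them. By continuity the same \<open>d\<close> serves all
  constraints active at any feasible \<open>x\<close> near \<open>xb\<close>. For feasible
  \<open>x'\<close>, concavity lets an active gradient at \<open>x\<close> point along
  \<open>x' - x\<close> only up to a quadratic amount \<open>c |x' - x|^2\<close>; adding a multiple
  of \<open>d\<close> of that order gives a feasible direction. Testing a regular normal
  \<open>v\<close> on it bounds \<open>v . (x' - x)\<close> by a constant times
  \<open>|v| |x' - x|^2\<close> (\<open>regular_normal_inequality_system\<close>). The bound
  survives limits of normals, and \<open>|v|\<close> is bounded near \<open>vb\<close>
  (\<open>prox_regular_inequality_system\<close>). \<open>concave_quadratic\<close> provides the
  derivatives and the curvature bound.\<close>

section \<open>A common descent direction for positively independent gradients\<close>

text \<open>Gordan's alternative: a convex combination of the \<open>g j\<close> equal to 0 would be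
  a nontrivial nonnegative relation, so 0 lies outside their compact convex hull and a hyperplane
  separates it strictly; \<open>d\<close> is the negated normal.\<close>

lemma Gordan_direction:
  fixes g :: "'i \<Rightarrow> 'a::euclidean_space"
  assumes "finite I"
    and indep: "\<And>y. \<lbrakk>\<And>j. j \<in> I \<Longrightarrow> 0 \<le> y j; (\<Sum>j\<in>I. y j *\<^sub>R g j) = 0\<rbrakk> \<Longrightarrow> \<forall>j\<in>I. y j = 0"
  obtains d \<delta> where "\<delta> > 0" "\<And>j. j \<in> I \<Longrightarrow> g j \<bullet> d < - \<delta>"
proof -
  \<comment> \<open>Weights are attached to indices, not to points, because \<open>g\<close> may
    take the same value at several indices.\<close>
  let ?K = "{\<Sum>j\<in>I. y j *\<^sub>R g j | y. (\<forall>j\<in>I. 0 \<le> y j) \<and> sum y I = (1::real)}"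
  have "convex ?K"
    unfolding convex_def
  proof clarify
    fix u v :: real and y y' :: "'i \<Rightarrow> real"
    assume uv: "0 \<le> u" "0 \<le> v" "u + v = 1" "\<forall>j\<in>I. 0 \<le> y j" "\<forall>j\<in>I. 0 \<le> y' j"
      "sum y I = 1" "sum y' I = 1"
    show "\<exists>y''. u *\<^sub>R (\<Sum>j\<in>I. y j *\<^sub>R g j) + v *\<^sub>R (\<Sum>j\<in>I. y' j *\<^sub>R g j) = (\<Sum>j\<in>I. y'' j *\<^sub>R g j) \<and>
        (\<forall>j\<in>I. 0 \<le> y'' j) \<and> sum y'' I = 1"
      using uv
      by (intro exI[of _ "\<lambda>j. u * y j + v * y' j"])
        (simp add: scaleR_sum_right scaleR_add_left sum.distrib flip: sum_distrib_left)
  qed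
  moreover have "g ` I \<subseteq> ?K"
  proof clarify
    fix i assume "i \<in> I"
    then show "\<exists>y. g i = (\<Sum>j\<in>I. y j *\<^sub>R g j) \<and> (\<forall>j\<in>I. 0 \<le> y j) \<and> sum y I = (1::real)"
      using \<open>finite I\<close> by (intro exI[of _ "\<lambda>j. if j = i then 1 else 0"])
        (simp add: if_distrib[of "\<lambda>c. c *\<^sub>R _"] sum.delta cong: if_cong)
  qed
  ultimately have "convex hull (g ` I) \<subseteq> ?K"
    by (rule hull_minimal[rotated])
  moreover have "0 \<notin> ?K"
    using indep by (force dest: sum.neutral)
  ultimately have "0 \<notin> convex hull (g ` I)" by blast
  moreover have "closed (convex hull (g ` I))"
    using \<open>finite I\<close> by (simp add: compact_convex_hull compact_imp_closed finite_imp_compact)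
  ultimately obtain a b where "0 < b" and ab: "\<And>x. x \<in> convex hull (g ` I) \<Longrightarrow> b < a \<bullet> x"
    using separating_hyperplane_closed_0[OF convex_convex_hull] by metis
  have "g j \<bullet> (- a) < - b" if "j \<in> I" for j
    using ab[of "g j"] that by (simp add: hull_inc inner_commute)
  with \<open>0 < b\<close> show ?thesis by (rule that)
qed

section \<open>Feasible directions and regular normals\<close>

lemma GDERIV_imp_isCont: "GDERIV f x :> D \<Longrightarrow> isCont f x"
  unfolding gderiv_def by (rule has_derivative_continuous)

lemma GDERIV_descent_direction:
  fixes f :: "'a::real_inner \<Rightarrow> real"
  assumes "GDERIV f x :> D" "D \<bullet> w < 0"
  shows "\<forall>\<^sub>F t in at_right 0. f (x + t *\<^sub>R w) < f x"
proof -
  have "(f has_derivative (\<lambda>h. h \<bullet> D)) (at (x + 0 *\<^sub>R w))"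
    using assms(1) by (simp add: gderiv_def)
  moreover have "((\<lambda>t. x + t *\<^sub>R w) has_derivative (\<lambda>t. t *\<^sub>R w)) (at 0)"
    by (auto intro!: derivative_eq_intros)
  ultimately have "((\<lambda>t. f (x + t *\<^sub>R w)) has_derivative (\<lambda>t. (t *\<^sub>R w) \<bullet> D)) (at 0)"
    by (rule has_derivative_compose[rotated])
  then have "((\<lambda>t. f (x + t *\<^sub>R w)) has_real_derivative (D \<bullet> w)) (at 0)"
    by (simp add: has_field_derivative_def inner_commute mult_commute_abs)
  from DERIV_neg_dec_right[OF this assms(2)] show ?thesis
    by (auto simp: eventually_at_right_field)
qed

text \<open>Apply the defining inequality of a regular normal at \<open>x + t w\<close>, divide by
  \<open>t\<close>, and let the error rate tend to 0.\<close>

lemma regular_normal_le_feasible_direction: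
  assumes v: "v \<in> regular_normal_cone C x"
    and feas: "\<forall>\<^sub>F t in at_right 0. x + t *\<^sub>R w \<in> C"
  shows "v \<bullet> w \<le> 0"
proof (rule field_le_epsilon)
  fix e :: real assume "0 < e"
  \<comment> \<open>The \<open>+ 1\<close> keeps the denominator positive when
    \<open>w = 0\<close>.\<close>
  define e' where "e' = e / (norm w + 1)"
  have "0 < e'" using \<open>0 < e\<close> by (simp add: e'_def add_nonneg_pos)
  then obtain \<delta> where "\<delta> > 0"
    and \<delta>: "\<And>x'. x' \<in> C \<Longrightarrow> norm (x' - x) < \<delta> \<Longrightarrow> v \<bullet> (x' - x) \<le> e' * norm (x' - x)"
    using v unfolding regular_normal_cone_def by blast
  have "((\<lambda>t. norm (t *\<^sub>R w)) \<longlongrightarrow> norm (0 *\<^sub>R w)) (at_right 0)"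
    by (intro tendsto_intros)
  then have "\<forall>\<^sub>F t in at_right 0. norm (t *\<^sub>R w) < \<delta>"
    using \<open>\<delta> > 0\<close> by (simp add: order_tendstoD(2))
  then have "\<forall>\<^sub>F t in at_right 0. x + t *\<^sub>R w \<in> C \<and> norm (t *\<^sub>R w) < \<delta> \<and> t > 0"
    using feas by (auto simp: eventually_conj_iff eventually_at_right_less)
  then obtain t where t: "x + t *\<^sub>R w \<in> C" "norm (t *\<^sub>R w) < \<delta>" "t > 0"
    by (metis (no_types, lifting) eventually_happens' trivial_limit_at_right_real)
  have "t * (v \<bullet> w) \<le> t * (e' * norm w)"
    using \<delta>[OF t(1)] t(2,3) by (simp add: mult.left_commute)
  then have "v \<bullet> w \<le> e' * norm w" using t(3) by simp
  also have "\<dots> \<le> e"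
    using \<open>0 < e\<close> by (simp add: e'_def pos_divide_le_eq add_nonneg_pos mult_left_mono)
  finally show "v \<bullet> w \<le> 0 + e" by simp
qed

section \<open>Prox-regularity of finite inequality systems\<close>

lemma closed_inequality_system:
  fixes f :: "'i \<Rightarrow> 'a::real_inner \<Rightarrow> real"
  assumes "\<And>j x. j \<in> J \<Longrightarrow> GDERIV (f j) x :> g j x"
  shows "closed {x. \<forall>j\<in>J. f j x \<le> 0}"
proof -
  have "closed {x. f j x \<le> 0}" if "j \<in> J" for j
    using GDERIV_imp_isCont[OF assms[OF that]]
    by (intro closed_Collect_le continuous_intros continuous_at_imp_continuous_on) auto
  moreover have "{x. \<forall>j\<in>J. f j x \<le> 0} = (\<Inter>j\<in>J. {x. f j x \<le> 0})" by auto
  ultimately show ?thesis by (simp add: closed_INT)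
qed

text \<open>A common descent direction \<open>d\<close> for the active constraints turns a step \<open>h = x' - x\<close> between
  feasible points into the direction \<open>h + \<kappa>\<parallel>h\<parallel>\<^sup>2 d\<close>, along which \<open>x\<close> can be moved strictly inside:
  the second-order correction absorbs the lower curvature of the constraints.\<close>

lemma regular_normal_inequality_system:
  fixes f :: "'i \<Rightarrow> 'a::euclidean_space \<Rightarrow> real" and J :: "'i set"
  defines "C \<equiv> {x. \<forall>j\<in>J. f j x \<le> 0}"
  assumes "finite J"
    and deriv: "\<And>j x. j \<in> J \<Longrightarrow> GDERIV (f j) x :> g j x"
    and curv: "\<And>j x y. j \<in> J \<Longrightarrow> f j x + g j x \<bullet> (y - x) - c * (norm (y - x))\<^sup>2 \<le> f j y"
    and d: "\<And>j. j \<in> J \<Longrightarrow> f j x = 0 \<Longrightarrow> g j x \<bullet> d < - \<delta>" and "\<delta> > 0" "c \<ge> 0"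
    and v: "v \<in> regular_normal_cone C x" and x': "x' \<in> C"
  shows "v \<bullet> (x' - x) \<le> c / \<delta> * norm d * norm v * (norm (x' - x))\<^sup>2"
proof (cases "x' = x")
  case False
  define h where "h = x' - x"
  \<comment> \<open>Chosen so that \<open>\<kappa> * \<delta> = c\<close>: the descent won along
    \<open>d\<close> cancels the curvature term \<open>c |h|^2\<close>.\<close>
  define \<kappa> where "\<kappa> = c / \<delta>"
  define w where "w = h + (\<kappa> * (norm h)\<^sup>2) *\<^sub>R d"
  have "norm h > 0" using False by (simp add: h_def)
  have "x \<in> C" using v by (simp add: regular_normal_cone_def)
  have "\<kappa> \<ge> 0" "\<kappa> * \<delta> = c"
    using \<open>\<delta> > 0\<close> \<open>c \<ge> 0\<close> by (simp_all add: \<kappa>_def)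
  \<comment> \<open>Only active constraints need descent along the direction; the others stay
    negative by continuity.\<close>
  have "\<forall>\<^sub>F t in at_right 0. f j (x + t *\<^sub>R w') \<le> 0"
    if "j \<in> J" and w': "f j x = 0 \<Longrightarrow> g j x \<bullet> w' < 0" for j w'
  proof (cases "f j x = 0")
    case True
    from GDERIV_descent_direction[OF deriv[OF \<open>j \<in> J\<close>] w'[OF True]] show ?thesis
      by (rule eventually_mono) (use True in simp)
  next
    case False
    with \<open>x \<in> C\<close> \<open>j \<in> J\<close> have "f j x < 0" by (force simp: C_def)
    moreover have "((\<lambda>t. f j (x + t *\<^sub>R w')) \<longlongrightarrow> f j x) (at_right 0)"
    proof (rule isCont_tendsto_compose[OF GDERIV_imp_isCont[OF deriv[OF \<open>j \<in> J\<close>]]])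
      have "((\<lambda>t. x + t *\<^sub>R w') \<longlongrightarrow> x + 0 *\<^sub>R w') (at_right 0)"
        by (intro tendsto_intros)
      then show "((\<lambda>t. x + t *\<^sub>R w') \<longlongrightarrow> x) (at_right 0)" by simp
    qed
    ultimately have "\<forall>\<^sub>F t in at_right 0. f j (x + t *\<^sub>R w') < 0"
      by (rule order_tendstoD(2)[rotated])
    then show ?thesis by (rule eventually_mono) simp
  qed
  then have feas: "\<forall>\<^sub>F t in at_right 0. x + t *\<^sub>R w' \<in> C"
    if "\<And>j. j \<in> J \<Longrightarrow> f j x = 0 \<Longrightarrow> g j x \<bullet> w' < 0" for w'
    using that \<open>finite J\<close> by (simp add: C_def eventually_ball_finite_distrib)
  \<comment> \<open>The extra \<open>e d\<close> makes the descent strict even after the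
    cancellation; \<open>e\<close> then decreases to 0.\<close>
  have le: "v \<bullet> (w + e *\<^sub>R d) \<le> 0" if "e > 0" for e
  proof (rule regular_normal_le_feasible_direction[OF v], rule feas)
    fix j assume j: "j \<in> J" "f j x = 0"
    \<comment> \<open>Here \<open>f j x = 0\<close> and \<open>f j x' \<le> 0\<close> enter the
      curvature bound.\<close>
    have "g j x \<bullet> h \<le> c * (norm h)\<^sup>2"
      using curv[OF j(1), of x x'] x' j by (force simp: h_def C_def)
    moreover have "(\<kappa> * (norm h)\<^sup>2 + e) * (g j x \<bullet> d) < (\<kappa> * (norm h)\<^sup>2 + e) * (- \<delta>)"
      using d[OF j] \<open>\<kappa> \<ge> 0\<close> \<open>e > 0\<close> by (intro mult_strict_left_mono) (auto intro: add_nonneg_pos)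
    moreover have "(\<kappa> * (norm h)\<^sup>2 + e) * (- \<delta>) = - c * (norm h)\<^sup>2 - e * \<delta>"
      using \<open>\<kappa> * \<delta> = c\<close> by (auto simp: algebra_simps)
    moreover have "g j x \<bullet> (w + e *\<^sub>R d) = g j x \<bullet> h + (\<kappa> * (norm h)\<^sup>2 + e) * (g j x \<bullet> d)"
      by (simp add: w_def inner_add_right algebra_simps)
    moreover have "e * \<delta> > 0" using \<open>e > 0\<close> \<open>\<delta> > 0\<close> by simp
    ultimately show "g j x \<bullet> (w + e *\<^sub>R d) < 0" by linarith
  qed
  have "((\<lambda>e. v \<bullet> (w + e *\<^sub>R d)) \<longlongrightarrow> v \<bullet> (w + 0 *\<^sub>R d)) (at_right 0)"
    by (intro tendsto_intros)
  then have "v \<bullet> (w + 0 *\<^sub>R d) \<le> 0"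
    by (rule tendsto_upperbound) (auto simp: eventually_at_right_field intro!: le exI[of _ 1])
  then have "v \<bullet> h \<le> - (\<kappa> * (norm h)\<^sup>2 * (v \<bullet> d))"
    by (simp add: w_def inner_add_right)
  also have "\<dots> \<le> \<kappa> * (norm h)\<^sup>2 * (norm v * norm d)"
  proof -
    have "- (v \<bullet> d) \<le> norm v * norm d"
      using Cauchy_Schwarz_ineq2[of v d] by linarith
    from mult_left_mono[OF this, of "\<kappa> * (norm h)\<^sup>2"] show ?thesis
      using \<open>\<kappa> \<ge> 0\<close> by simp
  qed
  finally show ?thesis by (simp add: h_def \<kappa>_def mult.commute mult.left_commute)
qed simp

text \<open>The estimate of the preceding lemma needs a descent direction at the base point
  \<open>x\<close>. One direction found at \<open>xb\<close> works uniformly in a neighborhood,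
  which allows passing from regular to limiting normals with a fixed constant.\<close>

lemma prox_regular_inequality_system:
  fixes f :: "'i \<Rightarrow> 'a::euclidean_space \<Rightarrow> real" and J :: "'i set"
  defines "C \<equiv> {x. \<forall>j\<in>J. f j x \<le> 0}"
  assumes "finite J"
    and deriv: "\<And>j x. j \<in> J \<Longrightarrow> GDERIV (f j) x :> g j x"
    and cont: "\<And>j. j \<in> J \<Longrightarrow> isCont (g j) xb"
    and curv: "\<And>j x y. j \<in> J \<Longrightarrow> f j x + g j x \<bullet> (y - x) - c j * (norm (y - x))\<^sup>2 \<le> f j y"
    and xb: "xb \<in> C"
    and cq: "\<And>y. \<lbrakk>\<And>j. j \<in> J \<Longrightarrow> 0 \<le> y j; \<And>j. j \<in> J \<Longrightarrow> f j xb < 0 \<Longrightarrow> y j = 0;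
        (\<Sum>j\<in>J. y j *\<^sub>R g j xb) = 0\<rbrakk> \<Longrightarrow> \<forall>j\<in>J. y j = 0"
  shows "prox_regular C xb"
proof -
  have "closed C" unfolding C_def using deriv by (rule closed_inequality_system)
  define I where "I = {j \<in> J. f j xb = 0}"
  have "finite I" "I \<subseteq> J" using \<open>finite J\<close> by (auto simp: I_def)
  obtain \<delta> d where "\<delta> > 0" and d: "\<And>j. j \<in> I \<Longrightarrow> g j xb \<bullet> d < - \<delta>"
  proof (rule Gordan_direction[OF \<open>finite I\<close>, where g = "\<lambda>j. g j xb"])
    fix y assume y: "\<And>j. j \<in> I \<Longrightarrow> 0 \<le> y j" "(\<Sum>j\<in>I. y j *\<^sub>R g j xb) = 0"
    \<comment> \<open>Multipliers on the active set are extended by zero, which is the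
      complementarity that \<open>cq\<close> asks for.\<close>
    have "(\<Sum>j\<in>J. (if j \<in> I then y j else 0) *\<^sub>R g j xb) = (\<Sum>j\<in>I. y j *\<^sub>R g j xb)"
      using \<open>finite J\<close> \<open>I \<subseteq> J\<close> by (intro sum.mono_neutral_cong_right) auto
    with y have "\<forall>j\<in>J. (if j \<in> I then y j else 0) = 0"
      by (intro cq) (auto simp: I_def)
    with \<open>I \<subseteq> J\<close> show "\<forall>j\<in>I. y j = 0" by (metis subsetD)
  qed blast
  \<comment> \<open>One nonnegative constant dominating every \<open>c j\<close>.\<close>
  define c0 where "c0 = (\<Sum>j\<in>J. \<bar>c j\<bar>)"
  have "c0 \<ge> 0" by (simp add: c0_def sum_nonneg)
  have curv': "f j x + g j x \<bullet> (y - x) - c0 * (norm (y - x))\<^sup>2 \<le> f j y" if "j \<in> J" for j x y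
  proof -
    have "c j \<le> c0"
      using member_le_sum[of j J "\<lambda>j. \<bar>c j\<bar>"] that \<open>finite J\<close> by (simp add: c0_def)
    then have "c j * (norm (y - x))\<^sup>2 \<le> c0 * (norm (y - x))\<^sup>2" by (rule mult_right_mono) simp
    then show ?thesis using curv[OF that, of x y] by linarith
  qed
  \<comment> \<open>A constraint active at \<open>xb\<close> keeps its descent by continuity of its
    gradient; one inactive at \<open>xb\<close> stays inactive nearby, so no constraint becomes
    active unexpectedly.\<close>
  have "\<forall>\<^sub>F x in nhds xb. f j x = 0 \<longrightarrow> g j x \<bullet> d < - \<delta>" if "j \<in> J" for j
  proof (cases "f j xb = 0")
    case True
    have "((\<lambda>x. g j x \<bullet> d) \<longlongrightarrow> g j xb \<bullet> d) (nhds xb)"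
      using cont[OF that] by (auto intro!: tendsto_intros simp: continuous_at tendsto_at_iff_tendsto_nhds)
    then have "\<forall>\<^sub>F x in nhds xb. g j x \<bullet> d < - \<delta>"
      using d[of j] that True by (intro order_tendstoD(2)) (auto simp: I_def)
    then show ?thesis by (rule eventually_mono) simp
  next
    case False
    have "(f j \<longlongrightarrow> f j xb) (nhds xb)"
      using GDERIV_imp_isCont[OF deriv[OF that]] by (simp add: continuous_at tendsto_at_iff_tendsto_nhds)
    then have "\<forall>\<^sub>F x in nhds xb. f j x \<noteq> 0"
      using False by (rule tendsto_imp_eventually_ne)
    then show ?thesis by (rule eventually_mono) simp
  qed
  then have "\<forall>\<^sub>F x in nhds xb. \<forall>j\<in>J. f j x = 0 \<longrightarrow> g j x \<bullet> d < - \<delta>"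
    using \<open>finite J\<close> by (simp add: eventually_ball_finite_distrib)
  then obtain \<epsilon> where "\<epsilon> > 0"
    and active: "\<And>x j. dist x xb < \<epsilon> \<Longrightarrow> j \<in> J \<Longrightarrow> f j x = 0 \<Longrightarrow> g j x \<bullet> d < - \<delta>"
    unfolding eventually_nhds_metric by blast
  define \<rho> where "\<rho> = c0 / \<delta> * norm d"
  have "\<rho> \<ge> 0" using \<open>c0 \<ge> 0\<close> \<open>\<delta> > 0\<close> by (simp add: \<rho>_def)
  have limiting: "v \<bullet> (x' - x) \<le> \<rho> * norm v * (norm (x' - x))\<^sup>2"
    if v: "v \<in> limiting_normal_cone C x" and x: "norm (x - xb) < \<epsilon>" and x': "x' \<in> C" for x x' v
  proof -
    obtain xs vs where reg: "\<And>n. vs n \<in> regular_normal_cone C (xs n)"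
      and lim: "xs \<longlonglongrightarrow> x" "vs \<longlonglongrightarrow> v"
      using v unfolding limiting_normal_cone_def by blast
    have "(\<lambda>n. dist (xs n) xb) \<longlonglongrightarrow> dist x xb" by (intro tendsto_intros lim)
    then have "\<forall>\<^sub>F n in sequentially. dist (xs n) xb < \<epsilon>"
      using x by (intro order_tendstoD(2)) (auto simp: dist_norm)
    \<comment> \<open>The approximating base points eventually lie in the open
      \<open>\<epsilon>\<close>-ball, where the estimate for regular normals holds; both of its
      sides are continuous in the point and the normal.\<close>
    then have "\<forall>\<^sub>F n in sequentially.
        vs n \<bullet> (x' - xs n) \<le> \<rho> * norm (vs n) * (norm (x' - xs n))\<^sup>2"
    proof (rule eventually_mono)
      fix n assume "dist (xs n) xb < \<epsilon>"
      show "vs n \<bullet> (x' - xs n) \<le> \<rho> * norm (vs n) * (norm (x' - xs n))\<^sup>2"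
        unfolding \<rho>_def using \<open>finite J\<close> deriv curv' active[OF \<open>dist (xs n) xb < \<epsilon>\<close>] \<open>\<delta> > 0\<close> \<open>c0 \<ge> 0\<close>
          reg[of n, unfolded C_def] x'[unfolded C_def]
        by (rule regular_normal_inequality_system)
    qed
    then show ?thesis
      by (rule tendsto_le[rotated 3, OF _ sequentially_bot]
          | intro tendsto_intros lim)+
  qed
  have "\<exists>\<epsilon>>0. \<exists>\<rho>\<ge>0. \<forall>x\<in>C. \<forall>v\<in>limiting_normal_cone C x. norm (x - xb) < \<epsilon> \<longrightarrow> norm (v - vb) < \<epsilon> \<longrightarrow>
      (\<forall>x'\<in>C. norm (x' - xb) < \<epsilon> \<longrightarrow> v \<bullet> (x' - x) \<le> \<rho> / 2 * (norm (x' - x))\<^sup>2)" for vb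
  \<comment> \<open>The radius is the same for every \<open>vb\<close>. The modulus depends on
    \<open>vb\<close> through \<open>|v| \<le> |vb| + \<epsilon>\<close>; its factor 2 offsets the
    half in \<open>prox_regular\<close>.\<close>
  proof (rule exI[of _ \<epsilon>], intro conjI, rule \<open>\<epsilon> > 0\<close>,
      rule exI[of _ "2 * \<rho> * (norm vb + \<epsilon>)"], intro conjI ballI impI)
    fix x v x'
    assume *: "x \<in> C" "v \<in> limiting_normal_cone C x" "norm (x - xb) < \<epsilon>" "norm (v - vb) < \<epsilon>" "x' \<in> C"
    have "norm v \<le> norm vb + \<epsilon>" using *(4) norm_triangle_ineq2[of v vb] by linarith
    then have "\<rho> * norm v * (norm (x' - x))\<^sup>2 \<le> \<rho> * (norm vb + \<epsilon>) * (norm (x' - x))\<^sup>2"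
      using \<open>\<rho> \<ge> 0\<close> by (intro mult_right_mono mult_left_mono) auto
    with limiting[OF *(2,3,5)]
    show "v \<bullet> (x' - x) \<le> 2 * \<rho> * (norm vb + \<epsilon>) / 2 * (norm (x' - x))\<^sup>2" by simp
  qed (use \<open>\<epsilon> > 0\<close> \<open>\<rho> \<ge> 0\<close> in auto)
  moreover have "locally_closed_at C xb"
    unfolding locally_closed_at_def using \<open>closed C\<close> by (intro exI[of _ 1]) auto
  ultimately show ?thesis using xb by (simp add: prox_regular_def)
qed

section \<open>The nonpositive orthant and its normal cone\<close>

lemma closedin_nonpos_orthant: "closedin (Euclidean_space m) (nonpos_orthant m)"
proof -
  have "closed {u :: nat \<Rightarrow> real. \<forall>j<m. u j \<le> 0}"
    by (intro closed_Collect_all closed_Collect_imp open_Collect_const closed_Collect_le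
        continuous_intros continuous_on_product_coordinates)
  then have "closedin (powertop_real UNIV) {u. \<forall>j<m. u j \<le> 0}"
    by (simp only: closed_closedin euclidean_product_topology)
  then show ?thesis
    unfolding Euclidean_space_def closedin_subtopology nonpos_orthant_def
    by (intro exI[of _ "{u. \<forall>j<m. u j \<le> 0}"]) auto
qed

lemma convex_in_nonpos_orthant: "convex_in (nonpos_orthant m)"
  unfolding convex_in_def nonpos_orthant_def topspace_Euclidean_space
  by (auto intro!: add_nonpos_nonpos mult_nonneg_nonpos)

text \<open>Complementary slackness, term by term: either \<open>y j = 0\<close>, or
  \<open>u j = 0\<close> and then \<open>w j \<le> 0\<close> meets \<open>y j \<ge> 0\<close>. It
  turns multipliers into normals to which the constraint qualification applies.\<close>

lemma convex_normal_cone_nonpos_orthantI: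
  assumes "u \<in> nonpos_orthant m" "y \<in> topspace (Euclidean_space m)"
    and "\<And>j. j < m \<Longrightarrow> 0 \<le> y j" "\<And>j. j < m \<Longrightarrow> u j < 0 \<Longrightarrow> y j = 0"
  shows "y \<in> convex_normal_cone m (nonpos_orthant m) u"
proof -
  have "y j * (w j - u j) \<le> 0" if "w \<in> nonpos_orthant m" "j < m" for w j
    using that assms(1,3) assms(4)[OF that(2)]
    by (cases "u j < 0") (auto simp: nonpos_orthant_def not_less intro!: mult_nonneg_nonpos
        dest: antisym)
  then have "(\<Sum>j<m. y j * (w j - u j)) \<le> 0" if "w \<in> nonpos_orthant m" for w
    using that by (intro sum_nonpos) auto
  then show ?thesis
    using assms(1,2) by (simp add: convex_normal_cone_def)
qed

text \<open>Bridge from inequality systems to the variational form: amenability is witnessed by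
  \<open>G\<close> itself on the whole space, and \<open>cq\<close> yields positive independence of
  the active gradients.\<close>

lemma strongly_amenable_prox_regular_orthant:
  fixes G :: "'a::euclidean_space \<Rightarrow> nat \<Rightarrow> real" and m :: nat
  defines "C \<equiv> {x. G x \<in> nonpos_orthant m}"
  assumes G: "\<And>x. G x \<in> topspace (Euclidean_space m)"
    and deriv: "\<And>j x. j < m \<Longrightarrow> GDERIV (\<lambda>x. G x j) x :> g j x"
    and deriv2: "\<And>j x. j < m \<Longrightarrow> (g j has_derivative blinfun_apply (h j x)) (at x)"
    and cont: "\<And>j. j < m \<Longrightarrow> continuous_on UNIV (h j)"
    and curv: "\<And>j x y. j < m \<Longrightarrow> G x j + g j x \<bullet> (y - x) - c j * (norm (y - x))\<^sup>2 \<le> G y j"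
    and xb: "xb \<in> C"
    and cq: "\<And>y. y \<in> convex_normal_cone m (nonpos_orthant m) (G xb) \<Longrightarrow>
      adjoint_jacobian m G xb y = 0 \<Longrightarrow> y = (\<lambda>_. 0)"
  shows "strongly_amenable C xb \<and> prox_regular C xb"
proof

  have "C2_on UNIV (\<lambda>x. G x j)" if "j < m" for j
    unfolding C2_on_def using deriv deriv2 cont that by blast
  then show "strongly_amenable C xb"
    unfolding strongly_amenable_def using xb G cq closedin_nonpos_orthant convex_in_nonpos_orthant
    by (intro conjI exI[of _ UNIV] exI[of _ m] exI[of _ G] exI[of _ "nonpos_orthant m"])
      (auto simp: C_def)
next
  have C_eq: "C = {x. \<forall>j\<in>{..<m}. G x j \<le> 0}"
    using G by (auto simp: C_def nonpos_orthant_def)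
  show "prox_regular C xb"
    unfolding C_eq
  proof (rule prox_regular_inequality_system[where f = "\<lambda>j x. G x j" and g = g and c = c])
    show "isCont (g j) xb" if "j \<in> {..<m}" for j
      using that deriv2 by (blast intro: has_derivative_continuous)
    show "xb \<in> {x. \<forall>j\<in>{..<m}. G x j \<le> 0}" using xb C_eq by simp
  next
    fix y :: "nat \<Rightarrow> real"
    assume y: "\<And>j. j \<in> {..<m} \<Longrightarrow> 0 \<le> y j" "\<And>j. j \<in> {..<m} \<Longrightarrow> G xb j < 0 \<Longrightarrow> y j = 0"
      "(\<Sum>j\<in>{..<m}. y j *\<^sub>R g j xb) = 0"
    \<comment> \<open>Elements of the normal cone are sequences vanishing from index
      \<open>m\<close> on, so the multipliers are cut off there.\<close>
    define y' where "y' j = (if j < m then y j else 0)" for j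
    have "y' \<in> convex_normal_cone m (nonpos_orthant m) (G xb)"
      using xb y(1,2)
      by (intro convex_normal_cone_nonpos_orthantI) (auto simp: C_def y'_def topspace_Euclidean_space)
    moreover have "adjoint_jacobian m G xb y' = 0"
      using y(3) grad_eqI[OF deriv] by (simp add: adjoint_jacobian_def y'_def)
    ultimately have "y' = (\<lambda>_. 0)" by (rule cq)
    then show "\<forall>j\<in>{..<m}. y j = 0"
      by (metis lessThan_iff y'_def)
  qed (use deriv curv in auto)
qed

section \<open>The observer's constraints as concave quadratics\<close>

lemma linear_inv_pow_mult: "linear (inv_pow_mult A i)"
  unfolding inv_pow_mult_def
  by (induction i) (auto simp only: funpow.simps linear_id matrix_vector_mul_linear intro: linear_compose)

lemma lin_pred_eq:
  fixes A V :: "real^'n^'n"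
  shows "lin_pred A V xh k i x =
     (2 *\<^sub>R (V *v prior A xh (k - i))) \<bullet> (inv_pow_mult A i x - prior A xh (k - i))"
proof -
  have "rowvector v $ (1::1) = v" for v :: "real^'n"
    by (simp add: rowvector_def vec_eq_iff)
  then show ?thesis
    unfolding lin_pred_def obs_row_def matrix_vector_mul_component by simp
qed

lemma spectral_norm_nonneg: "0 \<le> spectral_norm V"
  unfolding spectral_norm_def by (rule onorm_pos_le) (rule matrix_vector_mul_bounded_linear)

text \<open>Every component of the constraint map has this form, with \<open>T = A\<^sup>-\<^sup>i\<close> and \<open>b = \<plusminus>H\<^sup>T\<close>.\<close>

lemma concave_quadratic:
  fixes T :: "'a::euclidean_space \<Rightarrow> 'b::euclidean_space" and p b :: 'b and a L :: real
  defines "q \<equiv> \<lambda>x. a + b \<bullet> (T x - p) - L * (norm (T x - p))\<^sup>2"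
    and "g \<equiv> \<lambda>x. adjoint T (b - (2 * L) *\<^sub>R (T x - p))"
  assumes T: "linear T" and "L \<ge> 0"
  shows "GDERIV q x :> g x"
    and "(g has_derivative blinfun_apply (Blinfun (\<lambda>h. - ((2 * L) *\<^sub>R adjoint T (T h))))) (at x)"
    and "q x + g x \<bullet> (y - x) - L * (onorm T)\<^sup>2 * (norm (y - x))\<^sup>2 \<le> q y"
proof -
  interpret T: bounded_linear T using T by (rule linear_conv_bounded_linear[THEN iffD1])
  have adj: "linear (adjoint T)" using T by (rule adjoint_linear)
  interpret S: bounded_linear "adjoint T" using adj by (rule linear_conv_bounded_linear[THEN iffD1])
  have g: "g x \<bullet> h = b \<bullet> T h - 2 * L * ((T x - p) \<bullet> T h)" for h
    by (simp add: g_def adjoint_clauses[OF T] inner_diff_left)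
  have affine: "((\<lambda>x. T x - p) has_derivative T) (at x)"
    using has_derivative_diff[OF T.has_derivative[OF has_derivative_ident] has_derivative_const[of p]]
    by simp
  have "(q has_derivative (\<lambda>h. 0 + b \<bullet> T h - L * ((T x - p) \<bullet> T h + T h \<bullet> (T x - p)))) (at x)"
    unfolding q_def power2_norm_eq_inner
    by (intro has_derivative_add has_derivative_diff has_derivative_const has_derivative_mult_right
        has_derivative_inner has_derivative_inner_right affine)
  moreover have "(\<lambda>h. 0 + b \<bullet> T h - L * ((T x - p) \<bullet> T h + T h \<bullet> (T x - p))) = (\<lambda>h. h \<bullet> g x)"
    by (simp add: fun_eq_iff inner_commute[of _ "g x"] g inner_commute[of "T _" "T x - p"])
  ultimately show "GDERIV q x :> g x"
    by (simp only: gderiv_def)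
  \<comment> \<open>\<open>Blinfun\<close> returns its argument only for bounded linear maps. This
    one is the Hessian, the same at every \<open>x\<close>.\<close>
  have "bounded_linear (\<lambda>h. - ((2 * L) *\<^sub>R adjoint T (T h)))"
    by (rule bounded_linear_minus[OF bounded_linear_compose[OF bounded_linear_scaleR_right
        bounded_linear_compose[OF S.bounded_linear_axioms T.bounded_linear_axioms]]])
  then have B: "blinfun_apply (Blinfun (\<lambda>h. - ((2 * L) *\<^sub>R adjoint T (T h)))) =
      (\<lambda>h. - ((2 * L) *\<^sub>R adjoint T (T h)))"
    by (rule bounded_linear_Blinfun_apply)
  have "(g has_derivative (\<lambda>h. adjoint T (0 - (2 * L) *\<^sub>R T h))) (at x)"
    unfolding g_def
    by (intro S.has_derivative has_derivative_diff has_derivative_const has_derivative_scaleR_right affine)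
  then show "(g has_derivative blinfun_apply (Blinfun (\<lambda>h. - ((2 * L) *\<^sub>R adjoint T (T h))))) (at x)"
    by (simp add: B linear_neg[OF adj] linear_cmul[OF adj])
  \<comment> \<open>The second-order expansion of a quadratic is exact: its remainder is
    \<open>- L |T (y - x)|^2\<close>, which the operator norm of \<open>T\<close> controls.\<close>
  have Ty: "T y - p = (T x - p) + T (y - x)" by (simp add: T.diff)
  have norm_eq: "(norm (T y - p))\<^sup>2 = (norm (T x - p))\<^sup>2 + 2 * ((T x - p) \<bullet> T (y - x)) + (norm (T (y - x)))\<^sup>2"
    unfolding Ty power2_norm_eq_inner inner_add_left inner_add_right
    by (simp add: inner_commute[of "T (y - x)" "T x - p"])
  have "b \<bullet> (T y - p) = b \<bullet> (T x - p) + b \<bullet> T (y - x)"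
    unfolding Ty by (rule inner_add_right)
  then have "q y = q x + g x \<bullet> (y - x) - L * (norm (T (y - x)))\<^sup>2"
    by (simp only: q_def g norm_eq distrib_left)
  moreover have "L * (norm (T (y - x)))\<^sup>2 \<le> L * (onorm T * norm (y - x))\<^sup>2"
    using \<open>L \<ge> 0\<close> by (intro mult_left_mono power_mono onorm T.bounded_linear_axioms) auto
  ultimately show "q x + g x \<bullet> (y - x) - L * (onorm T)\<^sup>2 * (norm (y - x))\<^sup>2 \<le> q y"
    by (simp add: power_mult_distrib)
qed

theorem proposition1:
  fixes A V Q :: "real^'n^'n" and N k :: nat and \<eta> :: real
    and x xh :: "nat \<Rightarrow> real^'n" and z :: "nat \<Rightarrow> real" and P :: "nat \<Rightarrow> real^'n^'n"
    and xb :: "real^'n"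
  assumes V: "pos_def V"
    and state: "\<And>j. x (j + 1) = A *v x j"
    and measurement: "\<And>j. z j = x j \<bullet> (V *v x j)"
    and Q: "pos_def Q" and \<eta>: "\<eta> > 0"
    and observer: "quadratic_observer A V N 0 Q \<eta> z xh P"
    and k: "k \<ge> N + 1"
    and xb: "xb \<in> feasible A V N 0 z xh k"
    and invertibility: "invertible A"
    and nondegeneracy:
      "\<forall>i\<le>N. (phi_plus A V 0 z xh k i xb = 0 \<longrightarrow> grad (phi_plus A V 0 z xh k i) xb \<noteq> 0) \<and>
              (phi_minus A V 0 z xh k i xb = 0 \<longrightarrow> grad (phi_minus A V 0 z xh k i) xb \<noteq> 0)"
    and constraint_qualification:
      "\<forall>y \<in> convex_normal_cone (2 * (N + 1)) (nonpos_orthant (2 * (N + 1)))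
               (constraint_map A V N 0 z xh k xb).
         adjoint_jacobian (2 * (N + 1)) (constraint_map A V N 0 z xh k) xb y = 0 \<longrightarrow> y = (\<lambda>_. 0)"
  shows "strongly_amenable (feasible A V N 0 z xh k) xb \<and>
         prox_regular (feasible A V N 0 z xh k) xb"
proof -
  let ?m = "2 * (N + 1)" and ?G = "constraint_map A V N 0 z xh k" and ?L = "spectral_norm V"
  \<comment> \<open>The sign \<open>s j\<close> merges both families: component \<open>j\<close>
    belongs to \<open>i = j div 2\<close>, with \<open>+\<close> for even and \<open>-\<close> for
    odd \<open>j\<close>.\<close>
  define s :: "nat \<Rightarrow> real" where "s j = (if even j then 1 else - 1)" for j
  define T where "T j = inv_pow_mult A (j div 2)" for j
  define p where "p j = prior A xh (k - j div 2)" for j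
  define b where "b j = s j *\<^sub>R (2 *\<^sub>R (V *v p j))" for j
  define a where "a j = - s j * innovation A V z xh (k - j div 2)" for j
  have G: "?G x j = a j + b j \<bullet> (T j x - p j) - ?L * (norm (T j x - p j))\<^sup>2" if "j < ?m" for x j
    using that by (simp add: constraint_map_def phi_plus_def phi_minus_def delta_def lin_pred_eq
        a_def b_def T_def p_def s_def)
  have T: "linear (T j)" for j
    unfolding T_def by (rule linear_inv_pow_mult)
  note q = concave_quadratic[OF T spectral_norm_nonneg[of V]]
  have "strongly_amenable {x. ?G x \<in> nonpos_orthant ?m} xb \<and>
      prox_regular {x. ?G x \<in> nonpos_orthant ?m} xb"
  proof (rule strongly_amenable_prox_regular_orthant)
    fix j assume j: "j < ?m"
    have Gj: "(\<lambda>x. ?G x j) = (\<lambda>x. a j + b j \<bullet> (T j x - p j) - ?L * (norm (T j x - p j))\<^sup>2)"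
      using G[OF j] by (rule ext)
    show "GDERIV (\<lambda>x. ?G x j) x :> adjoint (T j) (b j - (2 * ?L) *\<^sub>R (T j x - p j))" for x
      unfolding Gj by (rule q(1))
    show "?G x j + adjoint (T j) (b j - (2 * ?L) *\<^sub>R (T j x - p j)) \<bullet> (y - x) -
        ?L * (onorm (T j))\<^sup>2 * (norm (y - x))\<^sup>2 \<le> ?G y j" for x y
      unfolding G[OF j] by (rule q(3))
  next
    show "?G x \<in> topspace (Euclidean_space ?m)" for x
      by (simp add: constraint_map_def topspace_Euclidean_space)
    show "xb \<in> {x. ?G x \<in> nonpos_orthant ?m}"
      using xb by (simp only: feasible_eq_constraint_map)
  \<comment> \<open>Left are the second derivative, its continuity and the constraint qualification;
    the Hessian is constant, hence continuous.\<close>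
  qed (use q(2) constraint_qualification in \<open>blast intro: continuous_on_const\<close>)+
  then show ?thesis by (simp only: feasible_eq_constraint_map)
qed

end
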